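(* Let $\chi$ be a Dirichlet character of conductor $f\in\mathbb{Z}^+$, let $r$ and $n$ be positive integers, and let $w_1,\dots,w_r$ be positive real numbers. Then $$L_{q,r}(-n,\chi\mid w_1,\dots,w_r)=(-1)^r\frac{n!}{(n+r)!}\,B^{(r)}_{n+r,\chi}(q\mid w_1,\dots,w_r).$$
   Context: Let $q\in\mathbb{C}$ with $0<|q|<1$, fix a value of $\log q$, and put $q^x=\exp(x\log q)$, $[x]=\frac{1-q^x}{1-q}$. A Dirichlet character of conductor $f$ is viewed as a primitive character modulo $f$. The generalized multiple Changhee $q$-Bernoulli numbers attached to $\chi$, $B^{(r)}_{n,\chi}(q\mid w_1,\dots,w_r)$ ($n\ge 0$), are defined by $$(-t)^r\Big(\prod_{j=1}^rw_j\Big)\sum_{n_1,\dots,n_r=1}^{\infty}\Big(\prod_{k=1}^r\chi(n_k)\Big)q^{\sum_{m=1}^rw_mn_m}e^{\left[\sum_{m=1}^rw_mn_m\right]t}=\sum_{n=0}^{\infty}B^{(r)}_{n,\chi}(q\mid w_1,\dots,w_r)\frac{t^n}{n!}.$$ The Dirichlet type multiple Changhee $q$-$L$-function is $$L_{q,r}(s,\chi\mid w_1,\dots,w_r)=\Big(\prod_{j=1}^rw_j\Big)\sum_{n_1,\dots,n_r=1}^{\infty}\frac{\Big(\prod_{k=1}^r\chi(n_k)\Big)q^{\sum_{m=1}^rw_mn_m}}{\left[\sum_{m=1}^rw_mn_m\right]^s}.$$ At $s=-n$ with $n\ge1$ an integer, $[x]^{-s}$ is the ordinary power $[x]^n$.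 *)

theory Defs
  imports "HOL-Analysis.Analysis"
begin

definition dirichlet_char :: "nat \<Rightarrow> (nat \<Rightarrow> complex) \<Rightarrow> bool" where
  "dirichlet_char m ch \<longleftrightarrow>
     m > 0 \<and> ch 1 = 1 \<and>
     (\<forall>a b. ch (a * b) = ch a * ch b) \<and>
     (\<forall>a. ch (a + m) = ch a) \<and>
     (\<forall>a. ch a = 0 \<longleftrightarrow> \<not> coprime a m)"

text \<open>The conductor of a character modulo \<open>m\<close> is the least divisor \<open>d\<close> of \<open>m\<close> such that the
  character is induced by a character modulo \<open>d\<close>. The set is never empty, as it contains \<open>m\<close>.\<close>

definition dirichlet_conductor :: "nat \<Rightarrow> (nat \<Rightarrow> complex) \<Rightarrow> nat" where
  "dirichlet_conductor m ch =
     (LEAST d. d dvd m \<and> (\<exists>\<psi>. dirichlet_char d \<psi> \<and> (\<forall>a. coprime a m \<longrightarrow> ch a = \<psi> a)))"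

definition primitive_dirichlet_char :: "nat \<Rightarrow> (nat \<Rightarrow> complex) \<Rightarrow> bool" where
  "primitive_dirichlet_char f ch \<longleftrightarrow> dirichlet_char f ch \<and> dirichlet_conductor f ch = f"

text \<open>Throughout, \<open>l\<close> is the chosen value of the logarithm of \<open>q\<close>, that is, \<open>exp l = q\<close>.\<close>

definition q_power :: "complex \<Rightarrow> real \<Rightarrow> complex" where
  "q_power l x = exp (of_real x * l)"

definition q_bracket :: "complex \<Rightarrow> complex \<Rightarrow> real \<Rightarrow> complex" where
  "q_bracket q l x = (1 - q_power l x) / (1 - q)"

text \<open>The \<open>r\<close>-fold sums over positive integers are unordered sums over extensional functions on
  \<open>{1..r}\<close>. For \<open>0 < |q| < 1\<close> and positive weights they converge absolutely.\<close>

definition changhee_gf ::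
  "complex \<Rightarrow> complex \<Rightarrow> nat \<Rightarrow> (nat \<Rightarrow> complex) \<Rightarrow> (nat \<Rightarrow> real) \<Rightarrow> complex \<Rightarrow> complex" where
  "changhee_gf q l r ch w t =
     (- t) ^ r * of_real (\<Prod>j = 1..r. w j) *
     (\<Sum>\<^sub>\<infinity>\<nu> \<in> {1..r} \<rightarrow>\<^sub>E {1..}.
        (\<Prod>k = 1..r. ch (\<nu> k)) *
        q_power l (\<Sum>m = 1..r. w m * real (\<nu> m)) *
        exp (q_bracket q l (\<Sum>m = 1..r. w m * real (\<nu> m)) * t))"

text \<open>For \<open>0 < |q| < 1\<close> and positive weights the generating function is entire in \<open>t\<close>, so exactly
  one sequence satisfies the expansion below.\<close>

definition changhee_bernoulli ::
  "complex \<Rightarrow> complex \<Rightarrow> nat \<Rightarrow> (nat \<Rightarrow> complex) \<Rightarrow> (nat \<Rightarrow> real) \<Rightarrow> nat \<Rightarrow> complex" where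
  "changhee_bernoulli q l r ch w =
     (THE B. \<forall>t. (\<lambda>n. B n * t ^ n / fact n) sums changhee_gf q l r ch w t)"

text \<open>The complex power is taken with its principal branch. The brackets occurring here are nonzero,
  so at \<open>s = -n\<close> every branch gives the ordinary power \<open>[x] ^ n\<close>.\<close>

definition changhee_L ::
  "complex \<Rightarrow> complex \<Rightarrow> nat \<Rightarrow> (nat \<Rightarrow> complex) \<Rightarrow> (nat \<Rightarrow> real) \<Rightarrow> complex \<Rightarrow> complex" where
  "changhee_L q l r ch w s =
     of_real (\<Prod>j = 1..r. w j) *
     (\<Sum>\<^sub>\<infinity>\<nu> \<in> {1..r} \<rightarrow>\<^sub>E {1..}.
        (\<Prod>k = 1..r. ch (\<nu> k)) *
        q_power l (\<Sum>m = 1..r. w m * real (\<nu> m)) /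
        q_bracket q l (\<Sum>m = 1..r. w m * real (\<nu> m)) powr s)"

end

theory Submission imports Defs begin

text \<open>
  The generating function is \<open>(- t) ^ r * W\<close> times an absolutely convergent family of exponentials
  \<open>a \<nu> * exp (b \<nu> * t)\<close>, where \<open>W\<close> is the product of the weights, \<open>a \<nu>\<close> is the coefficient
  \<open>(\<Prod>k. \<chi> (\<nu> k)) * q ^ X\<close> with \<open>X = (\<Sum>m. w m * \<nu> m)\<close>, and \<open>b \<nu> = [X]\<close>. Expanding each
  exponential and exchanging the two summations shows that the coefficient of \<open>t ^ n / n!\<close> in the
  sum is the moment \<open>\<Sum>\<nu>. a \<nu> * b \<nu> ^ n\<close>, which times \<open>W\<close> is exactly \<open>L(-n)\<close>. The factor
  \<open>(- t) ^ r\<close> contributes the sign and shifts this coefficient to index \<open>n + r\<close>, where it is measured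
  against \<open>t ^ (n + r) / (n + r)!\<close>; this accounts for the factor \<open>(n + r)! / n!\<close>. Uniqueness of
  power series coefficients identifies the result with the Bernoulli number.

  The exchange (\<open>exp_family_sums\<close>) needs two facts. The coefficients are absolutely summable
  (\<open>coeff_abs_summable\<close>), because they factor over the coordinates into geometrically decaying
  terms times values of the periodic, hence bounded, character. The brackets are bounded
  (\<open>norm_q_bracket_le\<close>), because \<open>|q ^ X| < 1\<close>. The same inequality makes every bracket
  nonzero, so that the complex power in the \<open>L\<close>-function is an ordinary power.
\<close>

section \<open>Power series\<close>

lemma power_series_coeffs_unique:
  fixes c d :: "nat \<Rightarrow> complex"
  assumes c: "\<And>t. (\<lambda>n. c n * t ^ n) sums F t" and d: "\<And>t. (\<lambda>n. d n * t ^ n) sums F t"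
  shows "c = d"
proof -
  have radius: "fps_conv_radius (Abs_fps e) > 0"
    if e: "\<And>t. (\<lambda>n. e n * t ^ n) sums F t" for e
  proof -
    have "conv_radius e \<ge> norm (1::complex)"
      using sums_summable[OF e[of 1]] by (intro conv_radius_geI) auto
    then show ?thesis
      unfolding fps_conv_radius_def fps_nth_Abs_fps
      by (metis ereal_less(2) less_le_trans norm_one zero_less_one)
  qed
  have "eval_fps (Abs_fps c) t = F t" "eval_fps (Abs_fps d) t = F t" for t
    using sums_unique[OF c[of t]] sums_unique[OF d[of t]] by (simp_all add: eval_fps_def)
  then have "Abs_fps c = Abs_fps d"
    using radius[OF c] radius[OF d] by (intro eval_fps_eqD) auto
  then show ?thesis
    by (metis ext fps_nth_Abs_fps)
qed

text \<open>
  The double family over \<open>A\<close> and the exponential series is absolutely summable: summing over the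
  series first gives at most \<open>norm (a x) * exp (M * norm t)\<close>.
\<close>

lemma exp_family_sums:
  fixes a b :: "'x \<Rightarrow> complex"
  assumes a: "(\<lambda>x. norm (a x)) summable_on A" and b: "\<And>x. x \<in> A \<Longrightarrow> norm (b x) \<le> M"
  shows "(\<lambda>n. (\<Sum>\<^sub>\<infinity>x\<in>A. a x * b x ^ n) * t ^ n / fact n) sums (\<Sum>\<^sub>\<infinity>x\<in>A. a x * exp (b x * t))"
proof -
  define g where "g x n = a x * ((b x * t) ^ n / fact n)" for x and n :: nat
  have exp_series: "((\<lambda>n. z ^ n / fact n) has_sum exp z) UNIV"
    and norm_exp_series: "((\<lambda>n. norm (z ^ n / fact n)) has_sum exp (norm z)) UNIV" for z :: complex
  proof -
    have *: "(\<lambda>n. norm (z ^ n / fact n)) sums exp (norm z)"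
      using exp_converges[of "norm z"] by (simp add: norm_divide norm_power field_simps)
    show "((\<lambda>n. norm (z ^ n / fact n)) has_sum exp (norm z)) UNIV"
      using * by (intro norm_summable_imp_has_sum) (auto simp: sums_iff)
    have "(\<lambda>n. z ^ n / fact n) sums exp z"
      using exp_converges[of z] by (simp add: scaleR_conv_of_real field_simps)
    then show "((\<lambda>n. z ^ n / fact n) has_sum exp z) UNIV"
      using * by (intro norm_summable_imp_has_sum) (auto simp: sums_iff)
  qed
  have g_sum: "(g x has_sum a x * exp (b x * t)) UNIV" for x
    unfolding g_def by (intro has_sum_cmult_right exp_series)
  have norm_g_sum: "((\<lambda>n. norm (g x n)) has_sum norm (a x) * exp (norm (b x * t))) UNIV" for x
    unfolding g_def norm_mult[of "a x"] by (intro has_sum_cmult_right norm_exp_series)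
  have norm_g_summable: "(\<lambda>x. norm (a x) * exp (norm (b x * t))) summable_on A"
  proof (rule summable_on_comparison_test)
    show "(\<lambda>x. norm (a x) * exp (M * norm t)) summable_on A"
      by (intro summable_on_cmult_left a)
    show "norm (a x) * exp (norm (b x * t)) \<le> norm (a x) * exp (M * norm t)" if "x \<in> A" for x
      using b[OF that] by (auto intro!: mult_left_mono mult_right_mono simp: norm_mult)
  qed auto
  have "(\<lambda>p. norm (case p of (x, n) \<Rightarrow> g x n)) summable_on A \<times> (UNIV :: nat set)"
    using norm_g_sum norm_g_summable
    by (subst Infinite_Sum.abs_summable_on_Sigma_iff)
       (auto simp: infsumI[OF norm_g_sum] abs_mult intro: has_sum_imp_summable)
  then have double: "(\<lambda>(x, n). g x n) summable_on A \<times> (UNIV :: nat set)"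
    by (rule abs_summable_summable)
  then have double': "(\<lambda>(n, x). g x n) summable_on (UNIV :: nat set) \<times> A"
    by (subst summable_on_swap) (simp add: case_prod_unfold)
  have column: "(\<Sum>\<^sub>\<infinity>x\<in>A. g x n) = (\<Sum>\<^sub>\<infinity>x\<in>A. a x * b x ^ n) * t ^ n / fact n" for n
  proof -
    have "(\<Sum>\<^sub>\<infinity>x\<in>A. g x n) = (\<Sum>\<^sub>\<infinity>x\<in>A. (a x * b x ^ n) * (t ^ n / fact n))"
      by (simp add: g_def power_mult_distrib mult.assoc)
    also have "\<dots> = (\<Sum>\<^sub>\<infinity>x\<in>A. a x * b x ^ n) * (t ^ n / fact n)"
      by (rule infsum_cmult_left')
    finally show ?thesis by simp
  qed
  have "((\<lambda>n. \<Sum>\<^sub>\<infinity>x\<in>A. g x n) has_sum (\<Sum>\<^sub>\<infinity>n. \<Sum>\<^sub>\<infinity>x\<in>A. g x n)) UNIV"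
    using double' by (intro has_sum_infsum summable_on_Sigma_banach)
  also have "(\<Sum>\<^sub>\<infinity>n. \<Sum>\<^sub>\<infinity>x\<in>A. g x n) = (\<Sum>\<^sub>\<infinity>x\<in>A. \<Sum>\<^sub>\<infinity>n. g x n)"
    using infsum_swap_banach[OF double] by simp
  also have "\<dots> = (\<Sum>\<^sub>\<infinity>x\<in>A. a x * exp (b x * t))"
    by (simp only: infsumI[OF g_sum])
  finally show ?thesis
    unfolding column by (rule has_sum_imp_sums)
qed

section \<open>Coefficients and brackets\<close>

lemma dirichlet_char_bounded:
  assumes "dirichlet_char m ch"
  obtains C where "\<And>a. norm (ch a) \<le> C"
proof -
  have m: "m > 0" and step: "ch (a + m) = ch a" for a
    using assms by (auto simp: dirichlet_char_def)
  have "ch (a + k * m) = ch a" for a k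
    by (induction k) (use step in \<open>auto simp: algebra_simps\<close>, metis add.assoc add.commute step)
  then have periodic: "ch a = ch (a mod m)" for a
    by (metis mod_mult_div_eq mult.commute)
  have "norm (ch a) \<le> (\<Sum>b<m. norm (ch b))" for a
    using m by (subst periodic) (intro member_le_sum, auto)
  then show ?thesis by (rule that)
qed

lemma norm_q_power: "norm (q_power l x) = exp (x * Re l)"
  by (simp add: q_power_def)

lemma norm_q_power_less_one:
  assumes "Re l < 0" "x > 0"
  shows "norm (q_power l x) < 1"
  using assms by (simp add: norm_q_power mult_pos_neg)

lemma norm_q_bracket_le:
  assumes "Re l < 0" "x > 0"
  shows "norm (q_bracket q l x) \<le> 2 / norm (1 - q)"
  unfolding q_bracket_def norm_divide
  using norm_triangle_ineq4[of 1 "q_power l x"] norm_q_power_less_one[OF assms]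
  by (intro divide_right_mono) auto

lemma q_bracket_nonzero:
  assumes "Re l < 0" "x > 0" "q \<noteq> 1"
  shows "q_bracket q l x \<noteq> 0"
  using norm_q_power_less_one[OF assms(1,2)] assms(3) by (auto simp: q_bracket_def)

text \<open>
  As \<open>q_power l\<close> turns sums into products, the coefficient is a product of functions of the
  single coordinates, each dominated by a geometric series with ratio \<open>|q ^ w k| < 1\<close>.
\<close>

lemma coeff_abs_summable:
  fixes w :: "nat \<Rightarrow> real"
  assumes "Re l < 0" and ch: "\<And>a. norm (ch a) \<le> C" and w: "\<And>j. j \<in> {1..r} \<Longrightarrow> w j > 0"
  shows "(\<lambda>\<nu>. norm ((\<Prod>k = 1..r. ch (\<nu> k)) * q_power l (\<Sum>m = 1..r. w m * real (\<nu> m))))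
           summable_on ({1..r} \<rightarrow>\<^sub>E {1..})"
proof -
  define h where "h k n = ch n * q_power l (w k * real n)" for k n
  have factor: "(\<Prod>k = 1..r. ch (\<nu> k)) * q_power l (\<Sum>m = 1..r. w m * real (\<nu> m))
      = (\<Prod>k = 1..r. h k (\<nu> k))" for \<nu>
    by (simp add: h_def q_power_def prod.distrib sum_distrib_right exp_sum)
  have "(\<lambda>n. norm (h k n)) summable_on {1..}" if k: "k \<in> {1..r}" for k
  proof (rule summable_on_comparison_test)
    let ?\<rho> = "exp (w k * Re l)"
    have "?\<rho> < 1"
      using w[OF k] assms(1) by (simp add: mult_pos_neg)
    then have "(\<lambda>n. ?\<rho> ^ n) summable_on {1..}"
      by (intro summable_on_subset_banach[OF norm_summable_imp_summable_on]) auto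
    then show "(\<lambda>n. C * ?\<rho> ^ n) summable_on {1..}"
      by (rule summable_on_cmult_right)
    show "norm (h k n) \<le> C * ?\<rho> ^ n" for n
    proof -
      have "exp (w k * real n * Re l) = ?\<rho> ^ n"
        by (simp add: exp_of_nat_mult[symmetric] mult_ac)
      then show ?thesis
        using ch[of n] by (simp add: h_def norm_mult norm_q_power mult_right_mono)
    qed
  qed auto
  then have "Infinite_Set_Sum.abs_summable_on (\<lambda>\<nu>. \<Prod>k = 1..r. h k (\<nu> k)) ({1..r} \<rightarrow>\<^sub>E {1..})"
    by (intro abs_summable_on_prod_PiE) (auto simp flip: abs_summable_equivalent)
  then show ?thesis
    unfolding factor by (simp flip: abs_summable_equivalent)
qed

section \<open>Bernoulli numbers and values of the \<open>L\<close>-function\<close>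

lemma changhee_bernoulli_eqI:
  assumes "\<And>t. (\<lambda>n. B n * t ^ n / fact n) sums changhee_gf q l r ch w t"
  shows "changhee_bernoulli q l r ch w = B"
  unfolding changhee_bernoulli_def
proof (rule the_equality)
  fix B' assume "\<forall>t. (\<lambda>n. B' n * t ^ n / fact n) sums changhee_gf q l r ch w t"
  then have "(\<lambda>n. B' n / fact n) = (\<lambda>n. B n / fact n)"
    using assms by (intro power_series_coeffs_unique[where F = "changhee_gf q l r ch w"]) auto
  then show "B' = B"
    by (simp add: fun_eq_iff)
qed (use assms in auto)

theorem theorem18:
  fixes q l :: complex and ch :: "nat \<Rightarrow> complex" and f r n :: nat and w :: "nat \<Rightarrow> real"
  assumes "0 < cmod q" and "cmod q < 1" and "exp l = q"
    and "f > 0" and "primitive_dirichlet_char f ch"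
    and "r > 0" and "n > 0"
    and "\<And>j. j \<in> {1..r} \<Longrightarrow> w j > 0"
  shows "changhee_L q l r ch w (- of_nat n) =
           (-1) ^ r * (fact n / fact (n + r)) * changhee_bernoulli q l r ch w (n + r)"
proof -
  define A :: "(nat \<Rightarrow> nat) set" where "A = ({1..r} \<rightarrow>\<^sub>E {1..})"
  define X where "X \<nu> = (\<Sum>m = 1..r. w m * real (\<nu> m))" for \<nu> :: "nat \<Rightarrow> nat"
  define a where "a \<nu> = (\<Prod>k = 1..r. ch (\<nu> k)) * q_power l (X \<nu>)" for \<nu>
  define b where "b \<nu> = q_bracket q l (X \<nu>)" for \<nu>
  define W :: complex where "W = of_real (\<Prod>j = 1..r. w j)"
  define c where "c k = (\<Sum>\<^sub>\<infinity>\<nu>\<in>A. a \<nu> * b \<nu> ^ k)" for k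
  \<comment> \<open>\<open>t ^ r\<close> divides the generating function, so the first \<open>r\<close> Bernoulli numbers vanish.\<close>
  define B where "B k = (if k < r then 0 else (-1) ^ r * W * c (k - r) * fact k / fact (k - r))" for k

  have "exp (Re l) < 1"
    using assms(2,3) by (metis norm_exp_eq_Re)
  then have l: "Re l < 0" by simp
  have q: "q \<noteq> 1" using assms(2) by auto
  have X: "X \<nu> > 0" if "\<nu> \<in> A" for \<nu>
    unfolding X_def
  proof (rule sum_pos)
    fix m assume m: "m \<in> {1..r}"
    then have "\<nu> m \<ge> 1" using that PiE_mem[of \<nu> "{1..r}" "\<lambda>_. {1..}" m] by (simp add: A_def)
    then show "0 < w m * real (\<nu> m)" using assms(8)[OF m] by simp
  qed (use \<open>r > 0\<close> in auto)
  obtain C where C: "\<And>a. norm (ch a) \<le> C"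
    using assms(5) dirichlet_char_bounded unfolding primitive_dirichlet_char_def by blast
  have a: "(\<lambda>\<nu>. norm (a \<nu>)) summable_on A"
    unfolding a_def X_def A_def by (rule coeff_abs_summable[OF l C assms(8)])
  have b: "norm (b \<nu>) \<le> 2 / norm (1 - q)" if "\<nu> \<in> A" for \<nu>
    unfolding b_def by (rule norm_q_bracket_le[OF l X[OF that]])

  have "(\<lambda>k. B k * t ^ k / fact k) sums changhee_gf q l r ch w t" for t
  proof -
    have "(\<lambda>k. (-t) ^ r * W * (c k * t ^ k / fact k)) sums changhee_gf q l r ch w t"
      using sums_mult[OF exp_family_sums[OF a b, where t = t]]
      by (simp add: changhee_gf_def c_def a_def b_def X_def A_def W_def)
    also have "(\<lambda>k. (-t) ^ r * W * (c k * t ^ k / fact k))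
        = (\<lambda>k. B (k + r) * t ^ (k + r) / fact (k + r))"
      by (simp add: B_def fun_eq_iff power_minus[of t] power_add)
    finally show ?thesis
      by (subst (asm) sums_zero_iff_shift) (auto simp: B_def)
  qed
  then have "changhee_bernoulli q l r ch w = B"
    by (rule changhee_bernoulli_eqI)
  then have bernoulli: "changhee_bernoulli q l r ch w (n + r) = (-1) ^ r * W * c n * fact (n + r) / fact n"
    by (simp add: B_def)

  have "a \<nu> / b \<nu> powr (- of_nat n) = a \<nu> * b \<nu> ^ n" if "\<nu> \<in> A" for \<nu>
    using q_bracket_nonzero[OF l X[OF that] q]
    by (simp add: powr_minus powr_nat' b_def field_simps)
  then have "(\<Sum>\<^sub>\<infinity>\<nu>\<in>A. a \<nu> / b \<nu> powr (- of_nat n)) = c n"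
    unfolding c_def by (rule infsum_cong)
  then have "changhee_L q l r ch w (- of_nat n) = W * c n"
    unfolding changhee_L_def W_def a_def b_def X_def A_def by simp
  then show ?thesis
    by (simp add: bernoulli power_mult_distrib[symmetric] flip: mult.assoc)
qed

end
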